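(* Let $n \geq 1$ and let $G$ be an $n$-dimensional Euclidean crystallographic group. Then $G$ is not a generalized dicyclic group. Consequently, if $G$ is non-abelian, then $G$ is natural.
   Context: An $n$-dimensional crystallographic group is a discrete cocompact subgroup of the isometry group of Euclidean space $\mathbb{R}^n$. Generalized dicyclic groups: let $A$ be an abelian group and $y \in A$ an involution ($y \neq 1$, $y^2=1$). Adjoin an element $x \notin A$ with $x^2 = y$ and $x a x^{-1} = a^{-1}$ for all $a \in A$; the resulting group $\mathrm{Dic}(A,y) = \langle A, x \mid x^2=y,\ xax^{-1}=a^{-1}\ \forall a \in A\rangle$ contains $A$ as a subgroup of index $2$. It is called a generalized dicyclic group if it is non-abelian. A group is generalized dicyclic if it is isomorphic to such a group. A group $(G,* )$ is called natural if there exists a metric $d$ on the set $G$ such that (i) all right translations $x \mapsto x*a$ ($a \in G$) are isometries of $(G,d)$, and (ii) every group structure $(G,\circ)$ on the same set $G$ for which all right translations $x \mapsto x \circ a$ are isometries of $(G,d)$ is isomorphic as a group to $(G,* )$. *)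

theory Defs
  imports "HOL-Analysis.Analysis" "HOL-Algebra.Coset"
begin

subsection \<open>Crystallographic groups\<close>

definition isometry_group :: "('a::metric_space \<Rightarrow> 'a) monoid" where
  "isometry_group =
     \<lparr>carrier = {f. bij f \<and> (\<forall>x y. dist (f x) (f y) = dist x y)}, mult = (\<circ>), one = id\<rparr>"

lemma group_isometry_group: "group (isometry_group :: ('a::metric_space \<Rightarrow> 'a) monoid)"
proof (rule groupI)
  fix f :: "'a \<Rightarrow> 'a" assume f: "f \<in> carrier isometry_group"
  then have "bij f" by (simp add: isometry_group_def)
  have "dist (inv_into UNIV f x) (inv_into UNIV f y) = dist x y" for x y
    using f \<open>bij f\<close> by (simp add: isometry_group_def) (metis bij_inv_eq_iff)
  then have "inv_into UNIV f \<in> carrier isometry_group"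
    using \<open>bij f\<close> by (simp add: isometry_group_def bij_imp_bij_inv)
  moreover have "inv_into UNIV f \<circ> f = id"
    using \<open>bij f\<close> by (simp add: bij_def)
  ultimately show "\<exists>g\<in>carrier isometry_group. g \<otimes>\<^bsub>isometry_group\<^esub> f = \<one>\<^bsub>isometry_group\<^esub>"
    by (auto simp: isometry_group_def)
qed (auto simp: isometry_group_def bij_comp comp_assoc)

definition quotient_topology :: "'a topology \<Rightarrow> ('a \<Rightarrow> 'b) \<Rightarrow> 'b topology" where
  "quotient_topology X p =
     topology (\<lambda>U. U \<subseteq> p ` topspace X \<and> openin X {x \<in> topspace X. p x \<in> U})"

lemma openin_quotient_topology:
  "openin (quotient_topology X p) U \<longleftrightarrow>
     U \<subseteq> p ` topspace X \<and> openin X {x \<in> topspace X. p x \<in> U}"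
proof -
  have "istopology (\<lambda>U. U \<subseteq> p ` topspace X \<and> openin X {x \<in> topspace X. p x \<in> U})"
    unfolding istopology_def
  proof (intro conjI allI impI)
    fix S T
    assume S: "S \<subseteq> p ` topspace X \<and> openin X {x \<in> topspace X. p x \<in> S}"
      and T: "T \<subseteq> p ` topspace X \<and> openin X {x \<in> topspace X. p x \<in> T}"
    show "S \<inter> T \<subseteq> p ` topspace X" using S by blast
    have "{x \<in> topspace X. p x \<in> S \<inter> T} =
        {x \<in> topspace X. p x \<in> S} \<inter> {x \<in> topspace X. p x \<in> T}" by blast
    then show "openin X {x \<in> topspace X. p x \<in> S \<inter> T}" using S T by auto
  next
    fix \<K> assume K: "\<forall>K\<in>\<K>. K \<subseteq> p ` topspace X \<and> openin X {x \<in> topspace X. p x \<in> K}"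
    show "\<Union>\<K> \<subseteq> p ` topspace X" using K by blast
    have "{x \<in> topspace X. p x \<in> \<Union>\<K>} = (\<Union>K\<in>\<K>. {x \<in> topspace X. p x \<in> K})" by blast
    moreover have "openin X (\<Union>K\<in>\<K>. {x \<in> topspace X. p x \<in> K})"
      using K by (intro openin_Union) auto
    ultimately show "openin X {x \<in> topspace X. p x \<in> \<Union>\<K>}" by simp
  qed
  then show ?thesis by (simp add: quotient_topology_def)
qed

lemma quotient_map_quotient_topology: "quotient_map X (quotient_topology X p) p"
proof -
  have "{x \<in> topspace X. p x \<in> p ` topspace X} = topspace X" by blast
  then have "openin (quotient_topology X p) (p ` topspace X)"
    by (simp add: openin_quotient_topology)
  then have "topspace (quotient_topology X p) = p ` topspace X"
    by (metis openin_quotient_topology openin_subset openin_topspace subset_antisym)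
  then show ?thesis by (auto simp: quotient_map_def openin_quotient_topology)
qed

text \<open>
  Functions carry the product topology, i.e. the topology of pointwise convergence; on a group
  of isometries it agrees with the compact-open topology.  Cocompactness refers to the space of
  cosets of \<open>G\<close> in the full isometry group.
\<close>

definition crystallographic_group :: "(real ^ 'n \<Rightarrow> real ^ 'n) set \<Rightarrow> bool" where
  "crystallographic_group G \<longleftrightarrow>
     subgroup G isometry_group \<and>
     discrete G \<and>
     compact_space
       (quotient_topology (top_of_set (carrier isometry_group)) (\<lambda>f. G #>\<^bsub>isometry_group\<^esub> f))"


subsection \<open>Generalized dicyclic groups\<close>

text \<open>
  Every element of the group presented by
  \<open>\<langle>A, x | x\<^sup>2 = y, x a x\<^sup>-\<^sup>1 = a\<^sup>-\<^sup>1\<rangle>\<close> is uniquely of the form \<open>a\<close> or \<open>a x\<close> with \<open>a \<in> A\<close>;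
  these are encoded as \<open>(a, False)\<close> and \<open>(a, True)\<close>.
\<close>

definition Dic :: "('a, 'm) monoid_scheme \<Rightarrow> 'a \<Rightarrow> ('a \<times> bool) monoid" where
  "Dic A y =
     \<lparr>carrier = carrier A \<times> UNIV,
      mult = (\<lambda>(a, s) (b, t).
        (a \<otimes>\<^bsub>A\<^esub> (if s then inv\<^bsub>A\<^esub> b else b) \<otimes>\<^bsub>A\<^esub> (if s \<and> t then y else \<one>\<^bsub>A\<^esub>), s \<noteq> t)),
      one = (\<one>\<^bsub>A\<^esub>, False)\<rparr>"

context
  fixes A (structure) and y
  assumes A: "comm_group A" and y: "y \<in> carrier A" "y \<otimes> y = \<one>"
begin

interpretation comm_group A by (fact A)

lemma group_Dic: "group (Dic A y)"
proof (rule groupI)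
  have [simp]: "inv y = y" using y inv_equality by blast
  have [simp]: "y \<otimes> (y \<otimes> a) = a" if "a \<in> carrier A" for a
    using y that by (simp flip: m_assoc)
  show "u \<otimes>\<^bsub>Dic A y\<^esub> v \<otimes>\<^bsub>Dic A y\<^esub> w = u \<otimes>\<^bsub>Dic A y\<^esub> (v \<otimes>\<^bsub>Dic A y\<^esub> w)"
    if "u \<in> carrier (Dic A y)" "v \<in> carrier (Dic A y)" "w \<in> carrier (Dic A y)" for u v w
    using that y by (auto simp: Dic_def inv_mult m_ac)
  show "\<exists>v\<in>carrier (Dic A y). v \<otimes>\<^bsub>Dic A y\<^esub> u = \<one>\<^bsub>Dic A y\<^esub>"
    if u: "u \<in> carrier (Dic A y)" for u
  proof -
    obtain a s where "u = (a, s)" "a \<in> carrier A" using u by (auto simp: Dic_def)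
    then show ?thesis
      using y by (intro bexI[of _ "(if s then a \<otimes> y else inv a, s)"])
        (auto simp: Dic_def m_ac)
  qed
qed (use y in \<open>auto simp: Dic_def\<close>)

lemma Dic_relations:
  assumes "a \<in> carrier A" "b \<in> carrier A"
  shows "(a, False) \<otimes>\<^bsub>Dic A y\<^esub> (b, False) = (a \<otimes> b, False)"
    and "(a, False) \<otimes>\<^bsub>Dic A y\<^esub> (\<one>, True) = (a, True)"
    and "(\<one>, True) \<otimes>\<^bsub>Dic A y\<^esub> (\<one>, True) = (y, False)"
    and "(\<one>, True) \<otimes>\<^bsub>Dic A y\<^esub> (a, False) \<otimes>\<^bsub>Dic A y\<^esub> inv\<^bsub>Dic A y\<^esub> (\<one>, True) = (inv a, False)"
proof -
  interpret D: group "Dic A y" by (rule group_Dic)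
  show "(a, False) \<otimes>\<^bsub>Dic A y\<^esub> (b, False) = (a \<otimes> b, False)"
    "(a, False) \<otimes>\<^bsub>Dic A y\<^esub> (\<one>, True) = (a, True)"
    "(\<one>, True) \<otimes>\<^bsub>Dic A y\<^esub> (\<one>, True) = (y, False)"
    using assms y by (auto simp: Dic_def)
  have "(\<one>, True) \<otimes>\<^bsub>Dic A y\<^esub> (a, False) = (inv a, False) \<otimes>\<^bsub>Dic A y\<^esub> (\<one>, True)"
    using assms y by (auto simp: Dic_def)
  moreover have "(\<one>, True) \<in> carrier (Dic A y)" "(inv a, False) \<in> carrier (Dic A y)"
    using assms by (auto simp: Dic_def)
  ultimately show "(\<one>, True) \<otimes>\<^bsub>Dic A y\<^esub> (a, False) \<otimes>\<^bsub>Dic A y\<^esub> inv\<^bsub>Dic A y\<^esub> (\<one>, True)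
      = (inv a, False)"
    by (simp add: D.m_assoc)
qed

lemma Dic_universal:
  assumes H: "group H" and \<phi>: "\<phi> \<in> hom A H" and x: "x \<in> carrier H" "x \<otimes>\<^bsub>H\<^esub> x = \<phi> y"
    and conj: "\<And>a. a \<in> carrier A \<Longrightarrow> x \<otimes>\<^bsub>H\<^esub> \<phi> a \<otimes>\<^bsub>H\<^esub> inv\<^bsub>H\<^esub> x = inv\<^bsub>H\<^esub> (\<phi> a)"
  shows "\<exists>\<psi>\<in>hom (Dic A y) H. (\<forall>a\<in>carrier A. \<psi> (a, False) = \<phi> a) \<and> \<psi> (\<one>, True) = x"
proof -
  interpret H: group H by (rule H)
  interpret f: group_hom A H \<phi>
    using \<phi> H is_group by (simp add: group_hom_def group_hom_axioms_def)
  define \<psi> where "\<psi> = (\<lambda>(a, s). \<phi> a \<otimes>\<^bsub>H\<^esub> (if s then x else \<one>\<^bsub>H\<^esub>))"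
  have comm: "x \<otimes>\<^bsub>H\<^esub> \<phi> a = inv\<^bsub>H\<^esub> (\<phi> a) \<otimes>\<^bsub>H\<^esub> x" if "a \<in> carrier A" for a
    using conj[OF that] that x(1) by (metis H.inv_solve_right f.hom_closed H.m_closed H.inv_closed)
  have comm': "x \<otimes>\<^bsub>H\<^esub> (\<phi> a \<otimes>\<^bsub>H\<^esub> z) = inv\<^bsub>H\<^esub> (\<phi> a) \<otimes>\<^bsub>H\<^esub> (x \<otimes>\<^bsub>H\<^esub> z)"
    if "a \<in> carrier A" "z \<in> carrier H" for a z
    using comm[OF that(1)] that x(1) by (simp flip: H.m_assoc)
  have "\<psi> \<in> hom (Dic A y) H"
    using x y by (auto simp: hom_def \<psi>_def Dic_def H.m_assoc comm comm')
  then show ?thesis using x by (intro bexI[of _ \<psi>]) (auto simp: \<psi>_def)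
qed

end

text \<open>
  Taking \<open>A\<close> over the same element type as \<open>G\<close> is no restriction: any such \<open>A\<close> is isomorphic to
  a subgroup of \<open>Dic A y\<close>, hence of \<open>G\<close>.
\<close>

definition generalized_dicyclic :: "('a, 'm) monoid_scheme \<Rightarrow> bool" where
  "generalized_dicyclic G \<longleftrightarrow>
     (\<exists>(A :: 'a monoid) y. comm_group A \<and> y \<in> carrier A \<and> y \<noteq> \<one>\<^bsub>A\<^esub> \<and> y \<otimes>\<^bsub>A\<^esub> y = \<one>\<^bsub>A\<^esub> \<and>
        \<not> comm_group (Dic A y) \<and> G \<cong> Dic A y)"


subsection \<open>Natural groups\<close>

definition metric_isometry :: "'a set \<Rightarrow> ('a \<Rightarrow> 'a \<Rightarrow> real) \<Rightarrow> ('a \<Rightarrow> 'a) \<Rightarrow> bool" where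
  "metric_isometry M d f \<longleftrightarrow> bij_betw f M M \<and> (\<forall>x\<in>M. \<forall>y\<in>M. d (f x) (f y) = d x y)"

definition right_translations_isometric ::
    "('a, 'm) monoid_scheme \<Rightarrow> ('a \<Rightarrow> 'a \<Rightarrow> real) \<Rightarrow> bool" where
  "right_translations_isometric G d \<longleftrightarrow>
     (\<forall>a\<in>carrier G. metric_isometry (carrier G) d (\<lambda>x. x \<otimes>\<^bsub>G\<^esub> a))"

definition natural_group :: "('a, 'm) monoid_scheme \<Rightarrow> bool" where
  "natural_group G \<longleftrightarrow> group G \<and>
     (\<exists>d. Metric_space (carrier G) d \<and> right_translations_isometric G d \<and>
        (\<forall>H :: 'a monoid. group H \<and> carrier H = carrier G \<and> right_translations_isometric H d
           \<longrightarrow> H \<cong> G))"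

end

theory Submission
  imports Defs
begin

text \<open>
  The first claim rests on one element. In \<open>Dic A y\<close> the involution \<open>y\<close> is central: it commutes with
  the abelian group \<open>A\<close>, and with \<open>x\<close> because \<open>y = x\<^sup>2\<close>. In a crystallographic group \<open>G\<close>, a central
  element \<open>c\<close> has a displacement \<open>p \<mapsto> dist (c p) p\<close> that is constant on \<open>G\<close>-orbits. By cocompactness
  every orbit meets a fixed ball, so the displacement is bounded, and an isometry of bounded
  displacement is a translation. A translation is never an involution.

  For the second claim, choose a metric on \<open>G\<close> as rich as right invariance and symmetry
  permit: the distance from \<open>x\<close> to \<open>y\<close> determines the pair \<open>{x y\<^sup>-\<^sup>1, y x\<^sup>-\<^sup>1}\<close>, and all nonzero
  distances lie in \<open>{1<..<2}\<close>, which makes the triangle inequality automatic. Such a metric exists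
  as soon as \<open>G\<close> injects into the reals, and isometries of a separable space are determined by
  countably much data. An isometry followed by a right translation becomes a map \<open>f\<close> fixing \<open>1\<close>
  with \<open>f x (f y)\<^sup>-\<^sup>1 \<in> {x y\<^sup>-\<^sup>1, y x\<^sup>-\<^sup>1}\<close>. If every such \<open>f\<close> is the identity, then all isometries are
  right translations. For another group structure on the same set with isometric right
  translations, sending an element to the unique translation it performs is then an isomorphism.

  The core is therefore that a group that is neither abelian nor generalized dicyclic has no such
  \<open>f\<close> besides the identity. Each \<open>f x\<close> is \<open>x\<close> or \<open>x\<^sup>-\<^sup>1\<close>. Let \<open>I\<close> be the set of fixed elements and \<open>N\<close>
  its complement. Comparing the images of \<open>x \<in> I\<close> and \<open>y \<in> N\<close> gives \<open>y x y\<^sup>-\<^sup>1 = x\<^sup>-\<^sup>1\<close>. This is the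
  dicyclic relation, and it remains to find a subgroup of index two that is inverted by some \<open>y \<in> N\<close>.
  If \<open>I\<close> is not closed under multiplication, the centralizer of a suitable \<open>x \<in> I\<close> works;
  if \<open>I\<close> is closed and \<open>N N \<subseteq> I\<close>, then \<open>I\<close> itself works; otherwise \<open>f\<close> is inversion on the whole group,
  and the centralizer of any noncentral element works.
\<close>

section \<open>Recognizing generalized dicyclic groups\<close>

context group begin

definition inverts :: "'a \<Rightarrow> 'a \<Rightarrow> bool" where
  "inverts y a \<longleftrightarrow> y \<otimes> a = inv a \<otimes> y"

lemma inverts_iff:
  assumes "y \<in> carrier G" "a \<in> carrier G"
  shows "inverts y a \<longleftrightarrow> a \<otimes> (y \<otimes> a) = y"
  using assms by (auto simp: inverts_def inv_solve_left)

lemma inverts_iff_swap: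
  assumes "y \<in> carrier G" "a \<in> carrier G"
  shows "inverts y a \<longleftrightarrow> a \<otimes> y = y \<otimes> inv a"
  using assms by (auto simp: inverts_iff inv_solve_right m_assoc)

text \<open>
  Inversion is a homomorphism only on commuting elements, so conjugation by \<open>y\<close> cannot invert
  \<open>a\<close>, \<open>b\<close> and \<open>a b\<close> unless \<open>a\<close> and \<open>b\<close> commute. All commutativity in the classification below comes
  from here; in particular a subgroup that is inverted by one element is abelian.
\<close>

lemma inverts_mult_imp_commute:
  assumes "y \<in> carrier G" "a \<in> carrier G" "b \<in> carrier G"
    and "inverts y a" "inverts y b" "inverts y (a \<otimes> b)"
  shows "a \<otimes> b = b \<otimes> a"
proof -
  have "inv (a \<otimes> b) \<otimes> y = y \<otimes> a \<otimes> b"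
    using assms(1-3,6) by (simp add: inverts_def m_assoc)
  also have "\<dots> = inv a \<otimes> (y \<otimes> b)"
    using assms(1-4) by (simp add: inverts_def m_assoc)
  also have "\<dots> = inv (b \<otimes> a) \<otimes> y"
    using assms(1-3,5) by (simp add: inverts_def m_assoc inv_mult_group)
  finally show ?thesis
    using assms by (metis inv_inv inv_closed m_closed right_cancel)
qed

text \<open>
  Two inversions of \<open>x\<close> cancel. Hence, when everything outside the centralizer of \<open>x\<close> inverts \<open>x\<close>, that
  centralizer has index at most two.
\<close>

lemma inverts_both_imp_commute:
  assumes "g \<in> carrier G" "y \<in> carrier G" "x \<in> carrier G" "inverts g x" "inverts y x"
  shows "x \<otimes> (g \<otimes> inv y) = (g \<otimes> inv y) \<otimes> x"
proof -
  have "inv x \<otimes> inv y = inv (y \<otimes> x)" using assms by (simp add: inv_mult_group)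
  also have "\<dots> = inv y \<otimes> x" using assms by (simp add: inverts_def inv_mult_group)
  finally have "inv x \<otimes> inv y = inv y \<otimes> x" .
  moreover have "x \<otimes> (g \<otimes> inv y) = g \<otimes> (inv x \<otimes> inv y)"
    using assms by (simp add: inverts_iff_swap flip: m_assoc)
  ultimately show ?thesis using assms by (simp add: m_assoc)
qed

lemma subgroup_centralizer:
  assumes "x \<in> carrier G"
  shows "subgroup {a \<in> carrier G. x \<otimes> a = a \<otimes> x} G"
proof (rule subgroupI)
  show "inv a \<in> {a \<in> carrier G. x \<otimes> a = a \<otimes> x}" if "a \<in> {a \<in> carrier G. x \<otimes> a = a \<otimes> x}" for a
  proof -
    have a: "a \<in> carrier G" "a \<otimes> x = x \<otimes> a" using that by auto
    then have "x \<otimes> inv a = inv a \<otimes> x"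
      using assms by (simp add: inv_solve_left flip: m_assoc) (simp add: m_assoc)
    then show ?thesis using a by simp
  qed
  show "a \<otimes> b \<in> {a \<in> carrier G. x \<otimes> a = a \<otimes> x}"
    if "a \<in> {a \<in> carrier G. x \<otimes> a = a \<otimes> x}" "b \<in> {a \<in> carrier G. x \<otimes> a = a \<otimes> x}" for a b
    using that assms by (auto) (metis m_assoc)
qed (use assms in auto)

lemma comm_group_if_iso:
  assumes "comm_group H" "G \<cong> H"
  shows "comm_group G"
proof -
  interpret H: comm_group H by fact
  obtain h where h: "h \<in> hom G H" "inj_on h (carrier G)"
    using assms(2) by (auto simp: is_iso_def iso_def bij_betw_def)
  show ?thesis
  proof (rule group_comm_groupI)
    fix x y assume xy: "x \<in> carrier G" "y \<in> carrier G"
    have "h (x \<otimes> y) = h (y \<otimes> x)"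
      using xy h H.m_comm by (simp add: hom_def Pi_iff)
    then show "x \<otimes> y = y \<otimes> x" using h xy by (meson inj_onD m_closed)
  qed
qed

text \<open>
  The other parts of the dicyclic structure follow. The subgroup is abelian, because \<open>y\<close> inverts it.
  If \<open>y\<close> lay in \<open>A\<close>, it would invert itself, contradicting \<open>y\<^sup>2 \<noteq> 1\<close>. If \<open>y\<^sup>2\<close> lay outside \<open>A\<close>, the index
  condition would put \<open>y = y\<^sup>2 y\<^sup>-\<^sup>1\<close> in \<open>A\<close>. Finally \<open>y\<close> commutes with \<open>y\<^sup>2\<close> and inverts it, so \<open>y\<^sup>4 = 1\<close>.
\<close>

lemma generalized_dicyclicI:
  assumes A: "subgroup A G" and y: "y \<in> carrier G" "y \<otimes> y \<noteq> \<one>"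
    and inv: "\<And>a. a \<in> A \<Longrightarrow> inverts y a"
    and index: "\<And>g. \<lbrakk>g \<in> carrier G; g \<notin> A\<rbrakk> \<Longrightarrow> g \<otimes> inv y \<in> A"
    and nonabelian: "\<not> comm_group G"
  shows "generalized_dicyclic G"
proof -
  interpret A: subgroup A G by fact
  define B where "B = \<lparr>carrier = A, mult = (\<otimes>), one = \<one>\<rparr>"
  have comm: "a \<otimes> b = b \<otimes> a" if "a \<in> A" "b \<in> A" for a b
    using that inv y(1) by (intro inverts_mult_imp_commute[of y]) auto
  have B: "comm_group B"
  proof (rule comm_groupI)
    show "\<exists>b\<in>carrier B. b \<otimes>\<^bsub>B\<^esub> a = \<one>\<^bsub>B\<^esub>" if "a \<in> carrier B" for a
      using that by (intro bexI[of _ "inv a"]) (auto simp: B_def)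
    show "a \<otimes>\<^bsub>B\<^esub> b = b \<otimes>\<^bsub>B\<^esub> a" if "a \<in> carrier B" "b \<in> carrier B" for a b
      using that comm by (simp add: B_def)
  qed (auto simp: B_def m_assoc)
  have B_simps: "mult B = (\<otimes>)" "one B = \<one>" by (simp_all add: B_def)
  have inv_B: "inv\<^bsub>B\<^esub> a = inv a" if "a \<in> A" for a
    using that B by (intro group.inv_equality) (auto simp: B_def comm_group_def)
  have yA: "y \<notin> A" using inv[of y] y by (auto simp: inverts_def)
  have yy: "y \<otimes> y \<in> A"
    using index[of "y \<otimes> y"] y yA by (auto simp: m_assoc)
  have four: "(y \<otimes> y) \<otimes> (y \<otimes> y) = \<one>"
  proof -
    have "y \<otimes> y \<otimes> y = inv (y \<otimes> y) \<otimes> y" using inv[OF yy] y by (simp add: inverts_def m_assoc)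
    then have "y \<otimes> y = inv (y \<otimes> y)" using y by (simp del: inv_mult_group)
    then show ?thesis using y by (metis m_closed r_inv)
  qed
  define h where "h = (\<lambda>(a, s). a \<otimes> (if s then y else \<one>))"
  have 1: "y \<otimes> (b \<otimes> z) = inv b \<otimes> (y \<otimes> z)" if "b \<in> A" "z \<in> carrier G" for b z
    using inv[OF that(1)] that y by (simp add: inverts_def flip: m_assoc)
  have hom: "h \<in> hom (Dic B (y \<otimes> y)) G"
  proof (rule homI)
    fix u v assume "u \<in> carrier (Dic B (y \<otimes> y))" "v \<in> carrier (Dic B (y \<otimes> y))"
    then obtain a s b t where [simp]: "u = (a, s)" "v = (b, t)" and ab: "a \<in> A" "b \<in> A"
      by (auto simp: Dic_def B_def)
    show "h (u \<otimes>\<^bsub>Dic B (y \<otimes> y)\<^esub> v) = h u \<otimes> h v"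
      using ab y inv[of b] by (cases s; cases t)
        (auto simp: Dic_def h_def B_simps inv_B m_assoc 1 inverts_def)
  qed (use y in \<open>auto simp: Dic_def h_def B_def\<close>)
  have inj: "inj_on h (carrier (Dic B (y \<otimes> y)))"
  proof (rule inj_onI)
    fix u v assume uv: "u \<in> carrier (Dic B (y \<otimes> y))" "v \<in> carrier (Dic B (y \<otimes> y))" "h u = h v"
    then obtain a s b t where [simp]: "u = (a, s)" "v = (b, t)" and ab: "a \<in> A" "b \<in> A"
      by (auto simp: Dic_def B_def)
    have "y \<in> A" if "a = b \<otimes> y" "a \<in> A" "b \<in> A" for a b
    proof -
      have "inv b \<otimes> a \<in> A" using that by blast
      moreover have "inv b \<otimes> a = y" using that y by (simp flip: m_assoc)
      ultimately show ?thesis by simp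
    qed
    then show "u = v" using uv(3) ab yA y by (auto simp: h_def split: if_splits)
  qed
  have surj: "h ` carrier (Dic B (y \<otimes> y)) = carrier G"
  proof
    show "carrier G \<subseteq> h ` carrier (Dic B (y \<otimes> y))"
    proof
      fix g assume g: "g \<in> carrier G"
      show "g \<in> h ` carrier (Dic B (y \<otimes> y))"
      proof (cases "g \<in> A")
        case True
        then show ?thesis using g
          by (intro image_eqI[of _ _ "(g, False)"]) (auto simp: h_def Dic_def B_def)
      next
        case False
        then show ?thesis using g index[OF g] y
          by (intro image_eqI[of _ _ "(g \<otimes> inv y, True)"]) (auto simp: h_def Dic_def B_def m_assoc)
      qed
    qed
  qed (use hom in \<open>auto simp: hom_def\<close>)
  have B_sq: "y \<otimes> y \<in> carrier B" "(y \<otimes> y) \<otimes>\<^bsub>B\<^esub> (y \<otimes> y) = \<one>\<^bsub>B\<^esub>" "y \<otimes> y \<noteq> \<one>\<^bsub>B\<^esub>"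
    using yy four y by (auto simp: B_def)
  have D: "group (Dic B (y \<otimes> y))" using B B_sq by (intro group_Dic)
  have "Dic B (y \<otimes> y) \<cong> G" using hom inj surj by (auto simp: is_iso_def iso_def bij_betw_def)
  then have iso: "G \<cong> Dic B (y \<otimes> y)" using D by (simp add: group.iso_sym)
  then have "\<not> comm_group (Dic B (y \<otimes> y))" using nonabelian comm_group_if_iso iso by blast
  then show ?thesis using B B_sq iso unfolding generalized_dicyclic_def by blast
qed

end

section \<open>Rigidity of the coloured Cayley graph\<close>

text \<open>
  Colour the edge between \<open>x\<close> and \<open>y\<close> of the complete graph on a group by \<open>{x y\<^sup>-\<^sup>1, y x\<^sup>-\<^sup>1}\<close>. The right
  translations preserve colours and act simply transitively, so what matters is the stabilizer of
  \<open>1\<close>. Its members are the maps \<open>f\<close> below.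
\<close>

locale cayley_colour_automorphism = group G for G (structure) +
  fixes f
  assumes closed: "x \<in> carrier G \<Longrightarrow> f x \<in> carrier G"
    and one: "f \<one> = \<one>"
    and colour: "\<lbrakk>x \<in> carrier G; y \<in> carrier G\<rbrakk> \<Longrightarrow> f x \<otimes> inv (f y) \<in> {x \<otimes> inv y, y \<otimes> inv x}"
begin

definition Fixed :: "'a set" where "Fixed = {x \<in> carrier G. f x = x}"
definition Moved :: "'a set" where "Moved = {x \<in> carrier G. f x \<noteq> x}"

lemma Fixed_closed: "x \<in> Fixed \<Longrightarrow> x \<in> carrier G"
  and Moved_closed: "x \<in> Moved \<Longrightarrow> x \<in> carrier G"
  and Moved_iff: "x \<in> carrier G \<Longrightarrow> x \<in> Moved \<longleftrightarrow> x \<notin> Fixed"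
  by (auto simp: Fixed_def Moved_def)

lemma Moved_inv: "y \<in> Moved \<Longrightarrow> f y = inv y"
  using colour[of y \<one>] closed[of y] by (auto simp: Moved_def one)

lemma Moved_neq_inv: "y \<in> Moved \<Longrightarrow> inv y \<noteq> y"
  using Moved_inv[of y] by (auto simp: Moved_def)

lemma Moved_square: "y \<in> Moved \<Longrightarrow> y \<otimes> y \<noteq> \<one>"
  using Moved_neq_inv[of y] Moved_closed[of y] inv_equality[of y y] by blast

lemma inj:
  assumes "x \<in> carrier G" "y \<in> carrier G" "f x = f y"
  shows "x = y"
proof -
  have "\<one> \<in> {x \<otimes> inv y, y \<otimes> inv x}"
    using colour[OF assms(1,2)] closed[OF assms(2)] assms(3) by simp
  then have "x \<otimes> inv y = \<one> \<or> y \<otimes> inv x = \<one>" by (metis insertE singletonD)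
  then show ?thesis using assms(1,2) by (simp only: inv_solve_right' one_closed l_one) auto
qed

lemma inv_Moved:
  assumes "y \<in> Moved" shows "inv y \<in> Moved"
proof -
  have "f (inv y) \<noteq> f y"
    using inj[of "inv y" y] Moved_neq_inv Moved_closed inv_closed assms by blast
  then show ?thesis using Moved_inv[OF assms] Moved_closed[OF assms] by (simp add: Moved_def)
qed

text \<open>
  Since \<open>f\<close> fixes \<open>x\<close> and inverts \<open>y\<close>, the colour condition puts \<open>x y\<close> in \<open>{x y\<^sup>-\<^sup>1, y x\<^sup>-\<^sup>1}\<close>, and
  \<open>y \<noteq> y\<^sup>-\<^sup>1\<close> excludes the first possibility.
\<close>

lemma Moved_inverts_Fixed:
  assumes y: "y \<in> Moved" and x: "x \<in> Fixed"
  shows "inverts y x"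
proof -
  have c: "y \<in> carrier G" "x \<in> carrier G" using y x Fixed_closed Moved_closed by auto
  have "x \<otimes> y \<in> {x \<otimes> inv y, y \<otimes> inv x}"
    using colour[of x y] c x Moved_inv[OF y] by (simp add: Fixed_def)
  moreover have "x \<otimes> y \<noteq> x \<otimes> inv y" using Moved_neq_inv[OF y] c by simp
  ultimately have "x \<otimes> y = y \<otimes> inv x" by simp
  then show ?thesis using c by (simp add: inverts_iff_swap)
qed

lemma Moved_noncommuting_square_eq:
  assumes x: "x \<in> Moved" and y: "y \<in> Moved" and xy: "x \<otimes> y \<noteq> y \<otimes> x"
  shows "x \<otimes> x = y \<otimes> y"
proof -
  have c: "y \<in> carrier G" "x \<in> carrier G" using y x Moved_closed by auto
  have "inv x \<otimes> y \<in> {x \<otimes> inv y, y \<otimes> inv x}"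
    using colour[of x y] c Moved_inv x y by simp
  moreover have "inv x \<otimes> y \<noteq> y \<otimes> inv x"
  proof
    assume "inv x \<otimes> y = y \<otimes> inv x"
    then have "y = x \<otimes> (y \<otimes> inv x)" using c by (simp add: inv_solve_left')
    then show False using xy c by (simp add: inv_solve_right flip: m_assoc)
  qed
  ultimately have "inv x \<otimes> y = x \<otimes> inv y" by simp
  then have "y = x \<otimes> x \<otimes> inv y" using c by (simp add: inv_solve_left' m_assoc)
  then show ?thesis using c by (simp add: inv_solve_right)
qed

text \<open>
  Two fixed elements \<open>x\<close>, \<open>x'\<close> with a moved product \<open>y\<close> generate a quaternion group of order eight. The
  subgroup of index two is the centralizer of \<open>x\<close>. It consists of fixed elements, because moved
  elements invert \<open>x\<close> and \<open>x\<^sup>2 \<noteq> 1\<close>; so \<open>y\<close> inverts it. A fixed \<open>g\<close> outside it has \<open>g x\<close> moved, so \<open>g x\<close>,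
  and with it \<open>g\<close>, inverts \<open>x\<close>.
\<close>

lemma generalized_dicyclic_if_Fixed_not_closed:
  assumes x: "x \<in> Fixed" "x' \<in> Fixed" "x \<otimes> x' \<in> Moved" and nonabelian: "\<not> comm_group G"
  shows "generalized_dicyclic G"
proof -
  define y where "y = x \<otimes> x'"
  note inv_y = Moved_inverts_Fixed[OF x(3), folded y_def]
  have c: "x \<in> carrier G" "x' \<in> carrier G" "y \<in> carrier G"
    using x Fixed_closed by (auto simp: y_def)
  have yM: "y \<in> Moved" using x by (simp add: y_def)
  have comm: "a \<otimes> b = b \<otimes> a" if "a \<in> Fixed" "b \<in> Fixed" "a \<otimes> b \<in> Fixed" for a b
    using that inv_y c Fixed_closed by (intro inverts_mult_imp_commute[of y]) auto
  have x2: "x \<otimes> x \<noteq> \<one>"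
  proof
    assume xx: "x \<otimes> x = \<one>"
    then have ix: "inv x = x" using c inv_equality by blast
    have "y \<otimes> x = x \<otimes> y" using inv_y[OF x(1)] ix by (simp add: inverts_def)
    also have "\<dots> = x'" using c xx by (simp add: y_def flip: m_assoc)
    finally have yx: "y \<otimes> x = x'" .
    have "x' \<otimes> x = y \<otimes> (x \<otimes> x)" using c by (simp flip: yx add: m_assoc)
    then have x'x: "x' \<otimes> x = y" using c xx by simp
    have "y \<otimes> (x' \<otimes> x') = x' \<otimes> x \<otimes> (x' \<otimes> x')" by (simp only: x'x)
    also have "\<dots> = x' \<otimes> (y \<otimes> x')" using c by (simp add: y_def m_assoc)
    also have "\<dots> = y" using inv_y[OF x(2)] c by (simp add: inverts_iff)
    finally have x'x': "x' \<otimes> x' = \<one>" using c by simp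
    have "y \<otimes> y = x' \<otimes> x \<otimes> (x \<otimes> x')" by (simp add: x'x flip: y_def)
    also have "\<dots> = x' \<otimes> (x \<otimes> x) \<otimes> x'" using c by (simp add: m_assoc)
    finally have "y \<otimes> y = \<one>" using c xx x'x' by simp
    then show False using Moved_square[OF yM] by simp
  qed
  let ?A = "{a \<in> carrier G. x \<otimes> a = a \<otimes> x}"
  have Moved_inv_x: "inverts g x" if "g \<in> carrier G" "g \<notin> ?A" for g
  proof (cases "g \<in> Moved")
    case True then show ?thesis using Moved_inverts_Fixed x by blast
  next
    case False
    then have gF: "g \<in> Fixed" using that Moved_iff by blast
    have "g \<otimes> x \<notin> Fixed" using comm[of g x] gF x that by auto
    then have "g \<otimes> x \<in> Moved" using that c Moved_iff by blast
    then have "inverts (g \<otimes> x) x" using Moved_inverts_Fixed x by blast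
    then show ?thesis using that c by (simp add: inverts_def flip: m_assoc)
  qed
  show ?thesis
  proof (rule generalized_dicyclicI[of ?A y])
    show "subgroup ?A G" using c by (intro subgroup_centralizer)
    show "inverts y a" if a: "a \<in> ?A" for a
    proof (rule inv_y, rule ccontr)
      assume "a \<notin> Fixed"
      then have "inverts a x" using a Moved_iff Moved_inverts_Fixed x(1) by blast
      then have "a \<otimes> x = inv x \<otimes> a" by (simp add: inverts_def)
      then have "x \<otimes> a = inv x \<otimes> a" using a by auto
      then have "x = inv x" using a c right_cancel inv_closed by blast
      then show False using x2 c by (metis r_inv)
    qed
    show "g \<otimes> inv y \<in> ?A" if "g \<in> carrier G" "g \<notin> ?A" for g
      using inverts_both_imp_commute[of g y x] Moved_inv_x[OF that] inv_y[OF x(1)] that c by auto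
  qed (use c Moved_square[OF yM] nonabelian in simp_all)
qed

lemma generalized_dicyclic_if_Moved_mult_Fixed:
  assumes Fixed_mult: "\<And>a b. \<lbrakk>a \<in> Fixed; b \<in> Fixed\<rbrakk> \<Longrightarrow> a \<otimes> b \<in> Fixed"
    and Moved_mult: "\<And>a b. \<lbrakk>a \<in> Moved; b \<in> Moved\<rbrakk> \<Longrightarrow> a \<otimes> b \<in> Fixed"
    and y: "y \<in> Moved" and nonabelian: "\<not> comm_group G"
  shows "generalized_dicyclic G"
proof (rule generalized_dicyclicI[of Fixed y])
  show "subgroup Fixed G"
  proof (rule subgroupI)
    show "inv a \<in> Fixed" if "a \<in> Fixed" for a
      using that inv_Moved[of "inv a"] Moved_iff[of a] Moved_iff[of "inv a"] Fixed_closed[of a] by auto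
    show "Fixed \<noteq> {}" using one by (auto simp: Fixed_def)
    show "Fixed \<subseteq> carrier G" using Fixed_closed by blast
  qed (rule Fixed_mult)
  show "g \<otimes> inv y \<in> Fixed" if "g \<in> carrier G" "g \<notin> Fixed" for g
    using that Moved_iff Moved_mult inv_Moved y by blast
  show "y \<in> carrier G" "y \<otimes> y \<noteq> \<one>"
    using y by (rule Moved_closed, rule Moved_square)
  show "inverts y a" if "a \<in> Fixed" for a using y that by (rule Moved_inverts_Fixed)
qed (rule nonabelian)

text \<open>
  Let \<open>u\<close>, \<open>u'\<close> and \<open>u u'\<close> be moved. All three invert every fixed element \<open>x\<close>, while the product of two
  inversions centralizes it; hence \<open>x = x\<^sup>-\<^sup>1\<close>, and \<open>f\<close> is inversion on the whole group. The fixed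
  elements are central, so noncommuting elements are moved and have equal squares. Applied to
  \<open>a b\<close> and \<open>a\<close>, this shows that noncommuting elements invert each other. For noncommuting \<open>x\<close> and \<open>y\<close>,
  the centralizer of \<open>x\<close> is then the subgroup of index two inverted by \<open>y\<close>.
\<close>

lemma generalized_dicyclic_if_Moved_mult_Moved:
  assumes Fixed_mult: "\<And>a b. \<lbrakk>a \<in> Fixed; b \<in> Fixed\<rbrakk> \<Longrightarrow> a \<otimes> b \<in> Fixed"
    and u: "u \<in> Moved" "u' \<in> Moved" "u \<otimes> u' \<in> Moved" and nonabelian: "\<not> comm_group G"
  shows "generalized_dicyclic G"
proof -
  have square_Fixed: "inv x = x" if x: "x \<in> Fixed" for x
  proof -
    have c: "u \<in> carrier G" "u' \<in> carrier G" "x \<in> carrier G"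
      using u x Fixed_closed Moved_closed by auto
    have "x \<otimes> (u \<otimes> u') = inv x \<otimes> (u \<otimes> u')"
    proof -
      have "x \<otimes> u = u \<otimes> inv x"
        using Moved_inverts_Fixed[OF u(1) x] inverts_iff_swap[of u x] c by simp
      then have "x \<otimes> (u \<otimes> u') = u \<otimes> (inv x \<otimes> u')" using c by (simp flip: m_assoc)
      also have "\<dots> = u \<otimes> u' \<otimes> x"
        using Moved_inverts_Fixed[OF u(2) x] c by (simp add: inverts_def m_assoc)
      also have "\<dots> = inv x \<otimes> (u \<otimes> u')"
        using Moved_inverts_Fixed[OF u(3) x] by (simp add: inverts_def)
      finally show ?thesis .
    qed
    then have "x = inv x" using c by simp
    then show ?thesis by (rule sym)
  qed
  have central: "x \<otimes> g = g \<otimes> x" if x: "x \<in> Fixed" and g: "g \<in> carrier G" for x g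
  proof (cases "g \<in> Moved")
    case True
    then show ?thesis using Moved_inverts_Fixed[OF True x] square_Fixed[OF x] by (simp add: inverts_def)
  next
    case False
    then have "g \<in> Fixed" using g Moved_iff by blast
    then have "inverts u x" "inverts u g" "inverts u (x \<otimes> g)"
      using x Fixed_mult Moved_inverts_Fixed u by auto
    then show ?thesis using inverts_mult_imp_commute x g u Fixed_closed Moved_closed by blast
  qed
  have noncomm_Moved: "a \<in> Moved" if "a \<in> carrier G" "b \<in> carrier G" "a \<otimes> b \<noteq> b \<otimes> a" for a b
    using that central Moved_iff by metis
  have noncomm_square: "a \<otimes> a = b \<otimes> b" if "a \<in> carrier G" "b \<in> carrier G" "a \<otimes> b \<noteq> b \<otimes> a" for a b
    using that noncomm_Moved[of a b] noncomm_Moved[of b a] Moved_noncommuting_square_eq by metis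
  have noncomm_inverts: "inverts a b" if ab: "a \<in> carrier G" "b \<in> carrier G" "a \<otimes> b \<noteq> b \<otimes> a" for a b
  proof -
    have "(a \<otimes> b) \<otimes> a \<noteq> a \<otimes> (a \<otimes> b)" using ab by (simp add: m_assoc)
    then have "(a \<otimes> b) \<otimes> (a \<otimes> b) = a \<otimes> a" using ab by (intro noncomm_square) auto
    then have "b \<otimes> (a \<otimes> b) = a" using ab by (simp add: m_assoc)
    then show ?thesis using ab by (simp add: inverts_iff)
  qed
  obtain x y where xy: "x \<in> carrier G" "y \<in> carrier G" "y \<otimes> x \<noteq> x \<otimes> y"
    using nonabelian group_comm_groupI by metis
  let ?A = "{a \<in> carrier G. x \<otimes> a = a \<otimes> x}"
  have y_inverts_x: "inverts y x" using noncomm_inverts xy by metis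
  show ?thesis
  proof (rule generalized_dicyclicI[of ?A y])
    show "subgroup ?A G" using xy by (intro subgroup_centralizer)
    show "y \<otimes> y \<noteq> \<one>" using noncomm_Moved xy Moved_square by metis
    show "inverts y a" if a: "a \<in> ?A" for a
      \<comment> \<open>If \<open>a\<close> commutes with \<open>y\<close> as well as \<open>x\<close>, then \<open>a x\<close> does not commute with \<open>y\<close>, and the
        resulting equality \<open>y\<^sup>2 = (a x)\<^sup>2 = a\<^sup>2 x\<^sup>2 = a\<^sup>2 y\<^sup>2\<close> shows that \<open>a\<close> is fixed.\<close>
    proof (cases "y \<otimes> a = a \<otimes> y")
      case False
      then show ?thesis using noncomm_inverts[of y a] a xy by auto
    next
      case True
      have "y \<otimes> (a \<otimes> x) \<noteq> (a \<otimes> x) \<otimes> y"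
      proof
        assume "y \<otimes> (a \<otimes> x) = (a \<otimes> x) \<otimes> y"
        moreover have "y \<otimes> (a \<otimes> x) = a \<otimes> (y \<otimes> x)" using a xy True by (simp flip: m_assoc)
        ultimately have "a \<otimes> (y \<otimes> x) = a \<otimes> (x \<otimes> y)" using a xy by (simp add: m_assoc)
        then show False using a xy by simp
      qed
      then have "y \<otimes> y = (a \<otimes> x) \<otimes> (a \<otimes> x)" using a xy by (intro noncomm_square) auto
      also have "\<dots> = (a \<otimes> a) \<otimes> (x \<otimes> x)"
      proof -
        have "x \<otimes> (a \<otimes> x) = a \<otimes> (x \<otimes> x)" using a xy by (simp flip: m_assoc)
        then show ?thesis using a xy by (simp add: m_assoc)
      qed
      also have "x \<otimes> x = y \<otimes> y" using noncomm_square[of y x] xy by simp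
      finally have "a \<otimes> a = \<one>" using a xy by simp
      then have "a \<in> Fixed" using a Moved_iff Moved_square by blast
      then show ?thesis using Moved_inverts_Fixed noncomm_Moved xy by metis
    qed
    show "g \<otimes> inv y \<in> ?A" if "g \<in> carrier G" "g \<notin> ?A" for g
    proof -
      have "inverts g x" using that xy noncomm_inverts[of g x] by auto
      then show ?thesis using inverts_both_imp_commute[of g y x] y_inverts_x xy that by auto
    qed
  qed (use xy nonabelian in auto)
qed

theorem eq_id:
  assumes "\<not> comm_group G" "\<not> generalized_dicyclic G" "x \<in> carrier G"
  shows "f x = x"
proof (rule ccontr)
  assume "f x \<noteq> x"
  then have x: "x \<in> Moved" using assms by (simp add: Moved_def)
  have F: "a \<otimes> b \<in> Fixed" if "a \<in> Fixed" "b \<in> Fixed" for a b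
    using that generalized_dicyclic_if_Fixed_not_closed assms Moved_iff Fixed_closed m_closed by metis
  have M: "a \<otimes> b \<in> Fixed" if "a \<in> Moved" "b \<in> Moved" for a b
    using that generalized_dicyclic_if_Moved_mult_Moved[OF F] assms Moved_iff Moved_closed m_closed by metis
  show False using generalized_dicyclic_if_Moved_mult_Fixed[OF F M x] assms by blast
qed

end

section \<open>Natural groups\<close>
text \<open>
  The cardinality bound is what lets a real number encode the pair \<open>{x y\<^sup>-\<^sup>1, y x\<^sup>-\<^sup>1}\<close>.
\<close>

lemma (in group) natural_groupI:
  assumes card: "carrier G \<lesssim> (UNIV :: real set)"
    and nonabelian: "\<not> comm_group G" and not_dicyclic: "\<not> generalized_dicyclic G"
  shows "natural_group G"
proof -
  have "carrier G \<lesssim> {0<..<1::real}"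
    using card open_interval_eqpoll_reals[of 0 1] eqpoll_sym lepoll_trans2 by (metis zero_less_one)
  then obtain i0 where i0: "inj_on i0 (carrier G)" "i0 ` carrier G \<subseteq> {0<..<1::real}"
    by (auto simp: lepoll_def)
  \<comment> \<open>The value outside the carrier is arbitrary; it keeps \<open>d\<close> nonnegative everywhere, as a
    metric on the carrier is required to be.\<close>
  define i where "i x = (if x \<in> carrier G then i0 x else 1/2)" for x
  have i_range: "0 < i x" "i x < 1" for x using i0 by (auto simp: i_def)
  have i_inj: "x = y" if "i x = i y" "x \<in> carrier G" "y \<in> carrier G" for x y
    using that i0 by (auto simp: i_def dest: inj_onD)
  \<comment> \<open>Taking the minimum over an element and its inverse encodes the unordered pair.\<close>
  define d where "d x y = (if x = y then 0 else 1 + min (i (x \<otimes> inv y)) (i (y \<otimes> inv x)))" for x y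
  have d_range: "1 < d x y" "d x y < 2" if "x \<noteq> y" for x y
    using i_range that by (auto simp: d_def min_def)
  have d_colour: "x' \<otimes> inv y' \<in> {x \<otimes> inv y, y \<otimes> inv x}"
    if "d x' y' = d x y" "x \<in> carrier G" "y \<in> carrier G" "x' \<in> carrier G" "y' \<in> carrier G"
    for x y x' y'
  proof (cases "x = y")
    case True
    then show ?thesis using that d_range[of x' y'] by (cases "x' = y'") (auto simp: d_def)
  next
    case False
    then have "x' \<noteq> y'" using that d_range[of x y] by (auto simp: d_def[of x' y'])
    then have "min (i (x' \<otimes> inv y')) (i (y' \<otimes> inv x')) = min (i (x \<otimes> inv y)) (i (y \<otimes> inv x))"
      using that False by (simp add: d_def)
    then have "x' \<otimes> inv y' \<in> {x \<otimes> inv y, y \<otimes> inv x} \<or> y' \<otimes> inv x' \<in> {x \<otimes> inv y, y \<otimes> inv x}"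
      using that i_inj by (auto simp: min_def split: if_splits)
    moreover have "inv u \<in> {x \<otimes> inv y, y \<otimes> inv x}" if "u \<in> {x \<otimes> inv y, y \<otimes> inv x}" for u
      using that \<open>x \<in> carrier G\<close> \<open>y \<in> carrier G\<close> by (auto simp: inv_mult_group)
    moreover have "inv (y' \<otimes> inv x') = x' \<otimes> inv y'"
      using that by (simp add: inv_mult_group)
    ultimately show ?thesis by metis
  qed
  have metric: "Metric_space (carrier G) d"
  proof
    have d_self: "d x x = 0" for x by (simp add: d_def)
    show nonneg: "0 \<le> d x y" for x y
      using d_range(1)[of x y] d_self[of x] by (cases "x = y") simp_all
    show "d x y = d y x" for x y by (simp add: d_def min.commute)
    show "(d x y = 0) = (x = y)" for x y
      using d_range(1)[of x y] d_self[of x] by (cases "x = y") simp_all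
    show "d x z \<le> d x y + d y z" for x y z
    proof (cases "x = y \<or> y = z \<or> x = z")
      case True
      then show ?thesis using nonneg[of x y] nonneg[of y x] d_self[of x] d_self[of z] by auto
    next
      case False
      then show ?thesis using d_range[of x y] d_range[of y z] d_range[of x z] by simp
    qed
  qed
  have bij_right: "bij_betw (\<lambda>x. x \<otimes> a) (carrier G) (carrier G)" if "a \<in> carrier G" for a
    using that by (intro bij_betw_byWitness[of _ "\<lambda>x. x \<otimes> inv a"]) (auto simp: m_assoc)
  have right: "right_translations_isometric G d"
    unfolding right_translations_isometric_def metric_isometry_def
  proof (intro ballI conjI bij_right)
    fix a x y assume *: "a \<in> carrier G" "x \<in> carrier G" "y \<in> carrier G"
    have "(u \<otimes> a) \<otimes> inv (v \<otimes> a) = u \<otimes> inv v" if "u \<in> carrier G" "v \<in> carrier G" for u v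
      using that * by (simp add: inv_mult_group m_assoc) (simp flip: m_assoc)
    then show "d (x \<otimes> a) (y \<otimes> a) = d x y" using * by (simp add: d_def)
  qed
  have isometry_translation: "F x = x \<otimes> F \<one>"
    if F: "metric_isometry (carrier G) d F" and x: "x \<in> carrier G" for F x
  proof -
    have F_closed: "F y \<in> carrier G" if "y \<in> carrier G" for y
      using F that by (auto simp: metric_isometry_def bij_betw_def)
    define f where "f y = F y \<otimes> inv (F \<one>)" for y
    have "cayley_colour_automorphism G f"
    proof
      show "f y \<in> carrier G" if "y \<in> carrier G" for y using that F_closed by (simp add: f_def)
      show "f \<one> = \<one>" using F_closed by (simp add: f_def)
      fix y z assume yz: "y \<in> carrier G" "z \<in> carrier G"
      have "f y \<otimes> inv (f z) = F y \<otimes> inv (F z)"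
        using yz F_closed by (simp add: f_def inv_mult_group m_assoc) (simp flip: m_assoc)
      also have "\<dots> \<in> {y \<otimes> inv z, z \<otimes> inv y}"
        using F yz F_closed by (intro d_colour) (auto simp: metric_isometry_def)
      finally show "f y \<otimes> inv (f z) \<in> {y \<otimes> inv z, z \<otimes> inv y}" .
    qed
    then have "f x = x" using nonabelian not_dicyclic x by (rule cayley_colour_automorphism.eq_id)
    then show ?thesis using F_closed x by (metis f_def inv_solve_right' one_closed)
  qed
  have "H \<cong> G" if H: "group H" "carrier H = carrier G" "right_translations_isometric H d" for H :: "'a monoid"
  proof -
    interpret H: group H by fact
    have Hc: "a \<otimes>\<^bsub>H\<^esub> b \<in> carrier G" if "a \<in> carrier G" "b \<in> carrier G" for a b
      using H.m_closed that H(2) by auto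
    \<comment> \<open>Right multiplication by \<open>a\<close> in \<open>H\<close> is an isometry, hence right multiplication in \<open>G\<close> by the
      image of the identity of \<open>G\<close>; the identities of \<open>G\<close> and \<open>H\<close> may differ.\<close>
    define \<phi> where "\<phi> a = \<one> \<otimes>\<^bsub>H\<^esub> a" for a
    have \<phi>: "x \<otimes>\<^bsub>H\<^esub> a = x \<otimes> \<phi> a" if "x \<in> carrier G" "a \<in> carrier G" for x a
      using isometry_translation[of "\<lambda>x. x \<otimes>\<^bsub>H\<^esub> a" x] that H
      by (simp add: right_translations_isometric_def \<phi>_def)
    have \<phi>_closed: "\<phi> a \<in> carrier G" if "a \<in> carrier G" for a
      using that Hc by (simp add: \<phi>_def)
    have "\<phi> \<in> hom H G"
    proof (rule homI)
      fix a b assume "a \<in> carrier H" "b \<in> carrier H"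
      then have ab: "a \<in> carrier G" "b \<in> carrier G" using H(2) by auto
      have "\<phi> (a \<otimes>\<^bsub>H\<^esub> b) = \<phi> a \<otimes>\<^bsub>H\<^esub> b" using ab H(2) by (simp add: \<phi>_def H.m_assoc)
      then show "\<phi> (a \<otimes>\<^bsub>H\<^esub> b) = \<phi> a \<otimes> \<phi> b" using \<phi> \<phi>_closed ab by simp
    qed (use \<phi>_closed H(2) in simp)
    moreover have "bij_betw \<phi> (carrier H) (carrier G)"
    proof (rule bij_betw_byWitness[of _ "\<lambda>c. inv\<^bsub>H\<^esub> \<one> \<otimes>\<^bsub>H\<^esub> c"])
      have o: "\<one> \<in> carrier H" using H(2) by simp
      then show "\<forall>a\<in>carrier H. inv\<^bsub>H\<^esub> \<one> \<otimes>\<^bsub>H\<^esub> \<phi> a = a"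
        by (simp add: \<phi>_def flip: H.m_assoc)
      show "\<forall>a\<in>carrier G. \<phi> (inv\<^bsub>H\<^esub> \<one> \<otimes>\<^bsub>H\<^esub> a) = a"
        using o by (simp add: \<phi>_def flip: H.m_assoc H(2))
      show "(\<lambda>c. inv\<^bsub>H\<^esub> \<one> \<otimes>\<^bsub>H\<^esub> c) ` carrier G \<subseteq> carrier H"
        using o H.m_closed H.inv_closed by (auto simp flip: H(2))
    qed (use \<phi>_closed H(2) in auto)
    ultimately show ?thesis by (auto simp: is_iso_def iso_def)
  qed
  then show ?thesis
    using metric right group_axioms unfolding natural_group_def by blast
qed

section \<open>Central elements of crystallographic groups\<close>

lemma (in group) generalized_dicyclic_central_involution:
  assumes "generalized_dicyclic G"
  obtains c where "c \<in> carrier G" "c \<noteq> \<one>" "c \<otimes> c = \<one>"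
    "\<And>g. g \<in> carrier G \<Longrightarrow> g \<otimes> c = c \<otimes> g"
proof -
  obtain A :: "'a monoid" and y where A: "comm_group A" and y: "y \<in> carrier A" "y \<noteq> \<one>\<^bsub>A\<^esub>" "y \<otimes>\<^bsub>A\<^esub> y = \<one>\<^bsub>A\<^esub>"
    and iso: "G \<cong> Dic A y"
    using assms unfolding generalized_dicyclic_def by blast
  interpret A: comm_group A by fact
  have D: "group (Dic A y)" using A y by (intro group_Dic)
  have "Dic A y \<cong> G" using iso by (rule iso_sym)
  then obtain h where h: "h \<in> hom (Dic A y) G" "bij_betw h (carrier (Dic A y)) (carrier G)"
    by (auto simp: is_iso_def iso_def)
  interpret h: group_hom "Dic A y" G h
    using h D group_axioms by (simp add: group_hom_def group_hom_axioms_def)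
  have inv_y: "inv\<^bsub>A\<^esub> y = y" using y A.inv_equality by blast
  let ?c = "(y, False)"
  have c: "?c \<in> carrier (Dic A y)" "?c \<noteq> \<one>\<^bsub>Dic A y\<^esub>" "?c \<otimes>\<^bsub>Dic A y\<^esub> ?c = \<one>\<^bsub>Dic A y\<^esub>"
    using y by (auto simp: Dic_def)
  have comm: "u \<otimes>\<^bsub>Dic A y\<^esub> ?c = ?c \<otimes>\<^bsub>Dic A y\<^esub> u" if "u \<in> carrier (Dic A y)" for u
    using that y inv_y by (auto simp: Dic_def A.m_comm)
  show ?thesis
  proof
    show "h ?c \<in> carrier G" using c by simp
    show "h ?c \<noteq> \<one>"
      using c h(2) h.hom_one h.G.one_closed by (metis bij_betw_def inj_onD)
    show "h ?c \<otimes> h ?c = \<one>" using c by (metis h.hom_mult h.hom_one)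
    show "g \<otimes> h ?c = h ?c \<otimes> g" if "g \<in> carrier G" for g
    proof -
      have "g \<in> h ` carrier (Dic A y)" using bij_betw_imp_surj_on[OF h(2)] that by simp
      then obtain u where u: "u \<in> carrier (Dic A y)" "g = h u" by blast
      then show ?thesis using comm[OF u(1)] c(1) by (simp flip: h.hom_mult)
    qed
  qed
qed

text \<open>
  The displacement of the linear part \<open>L\<close> is bounded too, but it scales: \<open>L (t x) - t x = t (L x - x)\<close>.
  Letting \<open>t\<close> grow forces \<open>L x = x\<close>.
\<close>

lemma isometry_bounded_displacement_imp_translation:
  fixes f :: "'a::real_inner \<Rightarrow> 'a"
  assumes iso: "\<And>x y. dist (f x) (f y) = dist x y" and bound: "\<And>x. dist (f x) x \<le> B"
  shows "f x = x + f 0"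
proof -
  define L where "L x = f x - f 0" for x
  have "linear L"
    by (rule isometry_linear) (use iso in \<open>auto simp: L_def dist_norm\<close>)
  have "norm (L x - x) \<le> e" if e: "e > 0" for e
  proof -
    have bd: "norm (L z - z) \<le> B + norm (f 0)" for z
    proof -
      have "L z - z = (f z - z) - f 0" by (simp add: L_def)
      then have "norm (L z - z) \<le> norm (f z - z) + norm (f 0)" by (metis norm_triangle_ineq4)
      then show ?thesis using bound[of z] by (simp add: dist_norm)
    qed
    have "B \<ge> 0" using order_trans[OF zero_le_dist bound] .
    define t where "t = (B + norm (f 0) + 1) / e"
    have t: "t > 0" using e \<open>B \<ge> 0\<close> by (simp add: t_def add_nonneg_pos)
    have "L (t *\<^sub>R x) - t *\<^sub>R x = t *\<^sub>R (L x - x)"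
      by (simp add: linear_cmul[OF \<open>linear L\<close>] scaleR_diff_right)
    then have "t * norm (L x - x) \<le> B + norm (f 0)" using bd[of "t *\<^sub>R x"] t by simp
    also have "\<dots> \<le> t * e" using e by (simp add: t_def)
    finally show ?thesis using t by simp
  qed
  then have "norm (L x - x) \<le> 0" by (rule field_le_epsilon[where y=0, simplified])
  then show ?thesis by (simp add: L_def algebra_simps)
qed

text \<open>
  The cosets \<open>G f\<close> for which the orbit of \<open>f 0\<close> meets the ball of radius \<open>k\<close> form an open set, since
  evaluation at a point is continuous for pointwise convergence. These sets increase with \<open>k\<close> and
  cover the compact coset space, so one \<open>k\<close> suffices; translations \<open>f\<close> realize every point as \<open>f 0\<close>.
\<close>

lemma crystallographic_group_orbit_bound:
  fixes G :: "(real ^ 'n \<Rightarrow> real ^ 'n) set"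
  assumes "crystallographic_group G"
  obtains k where "\<And>p. \<exists>g\<in>G. norm (g p) < k"
proof -
  let ?I = "isometry_group :: (real ^ 'n \<Rightarrow> real ^ 'n) monoid"
  let ?q = "\<lambda>f. G #>\<^bsub>?I\<^esub> f"
  interpret I: group ?I by (rule group_isometry_group)
  have sub: "subgroup G ?I"
    and comp: "compact_space (quotient_topology (top_of_set (carrier ?I)) ?q)"
    using assms by (auto simp: crystallographic_group_def)
  have top: "topspace (quotient_topology (top_of_set (carrier ?I)) ?q) = ?q ` carrier ?I"
    using quotient_map_quotient_topology[of "top_of_set (carrier ?I)" ?q]
    by (simp add: quotient_map_def)
  define V where "V k = ?q ` {f \<in> carrier ?I. norm (f 0) < real k}" for k
  have V_iff: "?q f \<in> V k \<longleftrightarrow> (\<exists>g\<in>G. norm (g (f 0)) < real k)" if f: "f \<in> carrier ?I" for f k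
  proof
    assume "?q f \<in> V k"
    then obtain f' where f': "f' \<in> carrier ?I" "norm (f' 0) < real k" "?q f = ?q f'"
      by (auto simp: V_def)
    have "f' \<in> ?q f" using f' sub by (metis I.rcos_self)
    then obtain g where "g \<in> G" "f' = g \<circ> f" by (auto simp: r_coset_def isometry_group_def)
    then show "\<exists>g\<in>G. norm (g (f 0)) < real k" using f' by auto
  next
    assume "\<exists>g\<in>G. norm (g (f 0)) < real k"
    then obtain g where g: "g \<in> G" "norm (g (f 0)) < real k" by auto
    have "g \<otimes>\<^bsub>?I\<^esub> f \<in> ?q f" using g by (auto simp: r_coset_def)
    then have "?q f = ?q (g \<otimes>\<^bsub>?I\<^esub> f)" using I.repr_independence[OF _ f sub] by blast
    moreover have "g \<otimes>\<^bsub>?I\<^esub> f \<in> carrier ?I" using g f sub by (meson I.m_closed subgroup.mem_carrier)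
    moreover have "(g \<otimes>\<^bsub>?I\<^esub> f) 0 = g (f 0)" by (simp add: isometry_group_def)
    ultimately show "?q f \<in> V k" using g unfolding V_def by auto
  qed
  have "openin (quotient_topology (top_of_set (carrier ?I)) ?q) (V k)" for k
    unfolding openin_quotient_topology
  proof
    show "V k \<subseteq> ?q ` topspace (top_of_set (carrier ?I))" by (auto simp: V_def)
    have "{f \<in> topspace (top_of_set (carrier ?I)). ?q f \<in> V k} =
      carrier ?I \<inter> (\<Union>g\<in>G. {f. norm (g (f 0)) < real k})"
      using V_iff by auto
    moreover have "open {f :: real ^ 'n \<Rightarrow> real ^ 'n. norm (g (f 0)) < real k}" if "g \<in> G" for g
    proof -
      have "dist (g x) (g y) = dist x y" for x y
        using that sub subgroup.subset by (fastforce simp: isometry_group_def)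
      then have "continuous_on UNIV g" by (auto simp: continuous_on_iff)
      then have "continuous_on UNIV (\<lambda>f :: real ^ 'n \<Rightarrow> real ^ 'n. g (f 0))"
        by (rule continuous_on_compose2) auto
      then show ?thesis by (intro open_Collect_less continuous_on_norm continuous_on_const)
    qed
    ultimately show "openin (top_of_set (carrier ?I)) {f \<in> topspace (top_of_set (carrier ?I)). ?q f \<in> V k}"
      by (simp add: openin_open_Int open_UN)
  qed
  moreover have "?q ` carrier ?I \<subseteq> (\<Union>k. V k)"
  proof
    fix C assume "C \<in> ?q ` carrier ?I"
    then obtain f where "f \<in> carrier ?I" "C = ?q f" by auto
    moreover obtain k where "norm (f 0) < real k" using reals_Archimedean2 by blast
    ultimately show "C \<in> (\<Union>k. V k)" by (auto simp: V_def)
  qed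
  ultimately have "\<exists>\<F>. finite \<F> \<and> \<F> \<subseteq> range V \<and> ?q ` carrier ?I \<subseteq> \<Union>\<F>"
    using comp[unfolded compact_space_alt top, rule_format, of "range V"] by blast
  then obtain \<F> where \<F>: "finite \<F>" "\<F> \<subseteq> range V" "?q ` carrier ?I \<subseteq> \<Union>\<F>" by blast
  then obtain K where K: "finite K" "\<F> = V ` K" by (meson finite_subset_image)
  show ?thesis
  proof
    fix p :: "real ^ 'n"
    define f where "f = (\<lambda>x. x + p)"
    have "bij f" unfolding f_def by (intro bij_betw_byWitness[of _ "\<lambda>x. x - p"]) auto
    then have f: "f \<in> carrier ?I" by (simp add: f_def isometry_group_def)
    then obtain k where k: "k \<in> K" "?q f \<in> V k" using \<F> K by auto
    then obtain g where "g \<in> G" "norm (g (f 0)) < real k" using V_iff[OF f] by auto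
    moreover have "real k \<le> real (Max K)" using k K by simp
    moreover have "f 0 = p" by (simp add: f_def)
    ultimately show "\<exists>g\<in>G. norm (g p) < real (Max K)" by (metis order.strict_trans2)
  qed
qed

text \<open>
  As \<open>c\<close> is central, \<open>dist (c p) p = dist (c (g p)) (g p)\<close> for all \<open>g \<in> G\<close>. Choosing \<open>g\<close> to move \<open>p\<close> into a
  fixed ball bounds the displacement of \<open>c\<close>.
\<close>

lemma crystallographic_group_no_central_involution:
  fixes G :: "(real ^ 'n \<Rightarrow> real ^ 'n) set"
  assumes G: "crystallographic_group G" and c: "c \<in> G" "c \<circ> c = id"
    and central: "\<And>g. g \<in> G \<Longrightarrow> g \<circ> c = c \<circ> g"
  shows "c = id"
proof -
  have G_iso: "dist (g x) (g y) = dist x y" if "g \<in> G" for g x y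
    using G that subgroup.subset by (fastforce simp: crystallographic_group_def isometry_group_def)
  obtain k where k: "\<And>p. \<exists>g\<in>G. norm (g p) < k"
    using crystallographic_group_orbit_bound[OF G] by blast
  have bound: "dist (c p) p \<le> dist (c 0) 0 + 2 * k" for p
  proof -
    obtain g where g: "g \<in> G" "norm (g p) < k" using k by blast
    have "dist (c p) p = dist (g (c p)) (g p)" using G_iso g by simp
    also have "g (c p) = c (g p)" using central[OF g(1)] by (metis comp_apply)
    also have "dist (c (g p)) (g p) \<le> dist (c (g p)) (c 0) + dist (c 0) 0 + dist 0 (g p)"
      by (smt (verit) dist_triangle)
    also have "dist (c (g p)) (c 0) = norm (g p)" using G_iso c by simp
    finally show ?thesis using g by simp
  qed
  have trans: "c x = x + c 0" for x
    using isometry_bounded_displacement_imp_translation[OF G_iso[OF c(1)] bound] .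
  have "c (c 0) = 0" using c(2) by (metis comp_apply id_apply)
  then have "2 *\<^sub>R c 0 = 0" using trans[of "c 0"] by (simp add: scaleR_2)
  then have "c 0 = 0" by simp
  then show ?thesis using trans by (metis add.right_neutral eq_id_iff)
qed

section \<open>The cardinality of isometry groups\<close>

text \<open>
  An isometry is determined by its values on a countable dense set \<open>D\<close>, and each value by the
  rational balls around points of \<open>D\<close> that contain it. So an isometry is encoded by a subset of a
  countable set.
\<close>

lemma isometry_group_lepoll_reals:
  "carrier (isometry_group :: ('a :: {metric_space, second_countable_topology} \<Rightarrow> 'a) monoid)
     \<lesssim> (UNIV :: real set)"
proof -
  obtain D :: "'a set" where D: "countable D" "\<And>X. open X \<Longrightarrow> X \<noteq> {} \<Longrightarrow> \<exists>d\<in>D. d \<in> X"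
    using countable_dense_setE by blast
  let ?I = "isometry_group :: ('a \<Rightarrow> 'a) monoid"
  define code where "code f = {p \<in> D \<times> D \<times> \<rat>. case p of (d, e, r) \<Rightarrow> dist (f d) e < r}"
    for f :: "'a \<Rightarrow> 'a"
  have "inj_on code (carrier ?I)"
  proof (rule inj_onI, rule ext, rule ccontr)
    fix f g :: "'a \<Rightarrow> 'a" and x
    assume f: "f \<in> carrier ?I" and g: "g \<in> carrier ?I" and eq: "code f = code g" and ne: "f x \<noteq> g x"
    have iso: "dist (f u) (f v) = dist u v" "dist (g u) (g v) = dist u v" for u v
      using f g by (auto simp: isometry_group_def)
    define \<delta> where "\<delta> = dist (f x) (g x) / 4"
    have \<delta>: "\<delta> > 0" using ne by (simp add: \<delta>_def)
    obtain d where d: "d \<in> D" "d \<in> ball x \<delta>" using D(2)[of "ball x \<delta>"] \<delta> by auto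
    obtain r where r: "r \<in> \<rat>" "0 < r" "r < \<delta>" using Rats_dense_in_real[OF \<delta>] by auto
    obtain e where e: "e \<in> D" "e \<in> ball (f d) r" using D(2)[of "ball (f d) r"] r by auto
    have "(d, e, r) \<in> code f" using d e r by (simp add: code_def)
    then have "dist (g d) e < r" by (simp add: eq) (simp add: code_def)
    moreover have "dist (f d) e < r" using e by simp
    moreover have "dist (f x) (g x) \<le> dist (f x) (f d) + dist (f d) e + dist (g d) e + dist (g x) (g d)"
      by (smt (verit) dist_triangle dist_commute)
    ultimately show False using d r iso by (simp add: \<delta>_def)
  qed
  moreover have "code ` carrier ?I \<subseteq> Pow (D \<times> D \<times> \<rat>)" by (auto simp: code_def)
  ultimately have "carrier ?I \<lesssim> Pow (D \<times> D \<times> (\<rat> :: real set))" by (auto simp: lepoll_def)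
  also have "\<dots> \<lesssim> (UNIV :: nat set set)"
  proof -
    have "countable (D \<times> D \<times> (\<rat> :: real set))" by (intro countable_SIGMA D(1) countable_rat)
    then obtain n :: "_ \<Rightarrow> nat" where "inj_on n (D \<times> D \<times> (\<rat> :: real set))" by (auto simp: countable_def)
    then have "inj_on ((`) n) (Pow (D \<times> D \<times> \<rat>))" by (rule inj_on_image_Pow)
    then show ?thesis by (auto simp: lepoll_def)
  qed
  also have "\<dots> \<lesssim> (UNIV :: real set)" using nat_sets_eqpoll_reals by (rule eqpoll_imp_lepoll)
  finally show ?thesis .
qed

section \<open>Crystallographic groups are natural or abelian\<close>

theorem corollary17:
  fixes G :: "(real ^ 'n \<Rightarrow> real ^ 'n) set"
  assumes "crystallographic_group G"
  shows "\<not> generalized_dicyclic (isometry_group\<lparr>carrier := G\<rparr>) \<and>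
    (\<not> comm_group (isometry_group\<lparr>carrier := G\<rparr>) \<longrightarrow>
       natural_group (isometry_group\<lparr>carrier := G\<rparr>))"
proof -
  let ?G = "isometry_group\<lparr>carrier := G\<rparr>"
  have sub: "subgroup G isometry_group" using assms by (simp add: crystallographic_group_def)
  interpret group ?G by (rule subgroup.subgroup_is_group[OF sub group_isometry_group])
  have not_dicyclic: "\<not> generalized_dicyclic ?G"
  proof
    assume "generalized_dicyclic ?G"
    then obtain c where c: "c \<in> carrier ?G" "c \<noteq> \<one>\<^bsub>?G\<^esub>" "c \<otimes>\<^bsub>?G\<^esub> c = \<one>\<^bsub>?G\<^esub>"
      and central: "\<And>g. g \<in> carrier ?G \<Longrightarrow> g \<otimes>\<^bsub>?G\<^esub> c = c \<otimes>\<^bsub>?G\<^esub> g"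
      using generalized_dicyclic_central_involution by blast
    have "c = id"
    proof (rule crystallographic_group_no_central_involution[OF assms])
      show "c \<in> G" "c \<circ> c = id" using c by (simp_all add: isometry_group_def)
      show "g \<circ> c = c \<circ> g" if "g \<in> G" for g
        using central[of g] that by (simp add: isometry_group_def)
    qed
    then show False using c(2) by (simp add: isometry_group_def)
  qed
  have "carrier ?G \<lesssim> (UNIV :: real set)"
    using lepoll_trans[OF subset_imp_lepoll[OF subgroup.subset[OF sub]] isometry_group_lepoll_reals]
    by simp
  then show ?thesis using not_dicyclic natural_groupI by blast
qed

end
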